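(* Let $\Gamma$ be an $L$-connection on $M$ with horizontal projector $h$, torsion $T$, curvature $\Omega$ and associated almost-complex structure $F$. Let $B$ be an $L$-semibasic vector $2$-form on $M$ with $B^\circ+[C,h]=0$, and let $D$ be the reducible $L$-lift of $\Gamma$ corresponding to $B$. Then the torsion $\mathbf T$ of $D$ is given, for all $X,Y\in\mathfrak X(M)$, by $$\mathbf T(X,Y)=(F\circ T+\Omega)(X,Y)+(i_FB)(X,Y)+2FB(X,Y).$$
   Context: Everything is $C^\infty$. $M$ is a manifold of dimension $2n$ and $\mathfrak X(M)$ is its Lie algebra of vector fields. A vector $k$-form is a $TM$-valued (skew) $k$-form; a vector $1$-form is a field of endomorphisms of $TM$. Brackets of vector forms are Fr\"olicher--Nijenhuis brackets: for a vector field $X$ and vector $1$-forms $K,N$, $[X,K]Y=[X,KY]-K[X,Y]$ and $$[K,N](X,Y)=[KX,NY]+[NX,KY]+KN[X,Y]+NK[X,Y]-K[NX,Y]-N[KX,Y]-K[X,NY]-N[X,KY].$$ For a vector $1$-form $F$ and a vector $2$-form $B$, $(i_FB)(X,Y)=B(FX,Y)+B(X,FY)$. $L$ is a fixed vector $1$-form on $M$ of constant rank $n$ with $[L,L]=0$ and $\mathrm{Im}(L_z)=\mathrm{Ker}(L_z)$ for all $z\in M$ (so $L^2=0$). The vertical bundle is $V(M)=\mathrm{Im}\,L=\mathrm{Ker}\,L$. $C$ denotes the canonical vector field: a fixed vertical vector field on $M$ with $[C,L]=-L$. A vector form $K$ is $L$-semibasic if $LK=0$ and $i_XK=0$ for every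 vertical vector field $X$. An $L$-semispray is a vector field $S$ with $LS=C$. The potential of an $L$-semibasic vector $k$-form $K$ is $K^\circ=i_SK$, with $S$ an arbitrary $L$-semispray. An $L$-connection on $M$ is a vector $1$-form $\Gamma$ with $L\Gamma=L$ and $\Gamma L=-L$. Its vertical and horizontal projectors are $v=\frac12(I-\Gamma)$, $h=\frac12(I+\Gamma)$; its torsion is $T=\frac12[L,\Gamma]$; its curvature is $\Omega=-\frac12[h,h]$; its associated almost-complex structure is the vector $1$-form $F$ defined by $FL=h$ and $Fh=-L$. A linear connection $D$ on $M$ is $L$-almost-tangent if $D_X(LY)=L(D_XY)$ for all $X,Y$. Put $K(X)=D_XC$. $D$ is $L$-regular if it is $L$-almost-tangent and $K$ restricts to an isomorphism $V(M)\to V(M)$, with inverse $\varphi$; the $L$-connection induced by $D$ is then $I-2\varphi\circ K$, and $D$ is reducible if $D\Gamma=0$ for its induced $L$-connection $\Gamma$. $D$ is $L$-normal if it is $L$-almost-tangent and $D_{LX}C=LX$ for all $X$ (then it is $L$-regular). An $L$-lift of $\Gamma$ is an $L$-normal linear connection whose induced $L$-connection is $\Gamma$; it is a reducible $L$-lift if it is moreover reducible. The torsion of $D$ is $\mathbf T(X,Y)=D_XY-D_YX-[X,Y]$. The reducible $L$-lift of $\Gamma$ corresponding to $B$ is the unique reducible $L$-lift of $\Gamma$ with $\mathbf T(LX,Y)=B(X,Y)$ for all $X,Y\in\mathfrak X(M)$. *)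

theory Defs
  imports "HOL-Analysis.Analysis" "HOL-Library.Function_Algebras"
begin

section \<open>Pointwise real vector space structure on functions\<close>

text \<open>Together with \<open>Function_Algebras\<close>, this makes the sums and multiples below of functions,
  tangent vectors and vector fields the pointwise ones, and provides \<^const>\<open>dim\<close> for spaces of
  tangent vectors.\<close>

instantiation "fun" :: (type, real_vector) real_vector
begin

definition scaleR_fun :: "real \<Rightarrow> ('a \<Rightarrow> 'b) \<Rightarrow> 'a \<Rightarrow> 'b" where
  "scaleR_fun c f = (\<lambda>x. c *\<^sub>R f x)"

instance
  by standard (simp_all add: scaleR_fun_def fun_eq_iff scaleR_add_right scaleR_add_left)

end


section \<open>Smooth manifolds, tangent vectors, vector fields\<close>

primrec Ck_on :: "nat \<Rightarrow> ('e::euclidean_space \<Rightarrow> 'f::real_normed_vector) \<Rightarrow> 'e set \<Rightarrow> bool" where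
  "Ck_on 0 f S \<longleftrightarrow> continuous_on S f"
| "Ck_on (Suc k) f S \<longleftrightarrow>
     (\<forall>x\<in>S. f differentiable (at x)) \<and> (\<forall>v. Ck_on k (\<lambda>x. frechet_derivative f (at x) v) S)"

text \<open>Only used for open \<open>S\<close>.\<close>

definition smooth_on :: "('e::euclidean_space \<Rightarrow> 'f::real_normed_vector) \<Rightarrow> 'e set \<Rightarrow> bool" where
  "smooth_on f S \<longleftrightarrow> (\<forall>k. Ck_on k f S)"

text \<open>A manifold is a topology with an atlas of pairs (domain, chart map); its dimension is
  \<open>DIM('e)\<close>. The atlas need not be maximal.\<close>

record ('a, 'e) manifold =
  mtop :: "'a topology"
  charts :: "('a set \<times> ('a \<Rightarrow> 'e)) set"

abbreviation pts :: "('a, 'e) manifold \<Rightarrow> 'a set" where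
  "pts M \<equiv> topspace (mtop M)"

definition smooth_manifold :: "('a, 'e::euclidean_space) manifold \<Rightarrow> bool" where
  "smooth_manifold M \<longleftrightarrow>
     Hausdorff_space (mtop M) \<and> second_countable (mtop M) \<and>
     \<Union> (fst ` charts M) = pts M \<and>
     (\<forall>(U, \<phi>) \<in> charts M. openin (mtop M) U \<and> open (\<phi> ` U) \<and>
        homeomorphic_map (subtopology (mtop M) U) (top_of_set (\<phi> ` U)) \<phi>) \<and>
     (\<forall>(U, \<phi>) \<in> charts M. \<forall>(V, \<psi>) \<in> charts M.
        smooth_on (\<lambda>x. \<psi> (inv_into U \<phi> x)) (\<phi> ` (U \<inter> V)))"

text \<open>Functions, and below vector fields, are extended by zero outside the manifold, so that
  equality of these objects on the manifold is equality in HOL.\<close>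

definition C_inf :: "('a, 'e::euclidean_space) manifold \<Rightarrow> ('a \<Rightarrow> real) set" where
  "C_inf M = {f. (\<forall>p. p \<notin> pts M \<longrightarrow> f p = 0) \<and>
     (\<forall>(U, \<phi>) \<in> charts M. smooth_on (\<lambda>x. f (inv_into U \<phi> x)) (\<phi> ` U))}"

type_synonym 'a tvec = "('a \<Rightarrow> real) \<Rightarrow> real"
type_synonym 'a vfield = "'a \<Rightarrow> 'a tvec"
type_synonym 'a vform1 = "'a \<Rightarrow> 'a tvec \<Rightarrow> 'a tvec"
type_synonym 'a vform2 = "'a \<Rightarrow> 'a tvec \<Rightarrow> 'a tvec \<Rightarrow> 'a tvec"

text \<open>Tangent vectors at \<open>p\<close> are the derivations at \<open>p\<close> of the algebra of smooth functions
  (extended by zero to functions that are not smooth).\<close>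

definition tangent_space :: "('a, 'e::euclidean_space) manifold \<Rightarrow> 'a \<Rightarrow> 'a tvec set" where
  "tangent_space M p = {v.
     (\<forall>f. f \<notin> C_inf M \<longrightarrow> v f = 0) \<and>
     (\<forall>f\<in>C_inf M. \<forall>g\<in>C_inf M. v (f + g) = v f + v g) \<and>
     (\<forall>c. \<forall>f\<in>C_inf M. v (c *\<^sub>R f) = c * v f) \<and>
     (\<forall>f\<in>C_inf M. \<forall>g\<in>C_inf M. v (f * g) = f p * v g + g p * v f)}"

definition vector_fields :: "('a, 'e::euclidean_space) manifold \<Rightarrow> 'a vfield set" where
  "vector_fields M = {X.
     (\<forall>p\<in>pts M. X p \<in> tangent_space M p) \<and>
     (\<forall>p. p \<notin> pts M \<longrightarrow> X p = 0) \<and>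
     (\<forall>f\<in>C_inf M. (\<lambda>p. X p f) \<in> C_inf M)}"

definition lie_bracket :: "'a vfield \<Rightarrow> 'a vfield \<Rightarrow> 'a vfield" where
  "lie_bracket X Y = (\<lambda>p f. X p (\<lambda>q. Y q f) - Y p (\<lambda>q. X q f))"


section \<open>Vector forms and their brackets\<close>

definition app1 :: "'a vform1 \<Rightarrow> 'a vfield \<Rightarrow> 'a vfield" (infixr \<open>\<odot>\<close> 80) where
  "K \<odot> X = (\<lambda>p. K p (X p))"

definition app2 :: "'a vform2 \<Rightarrow> 'a vfield \<Rightarrow> 'a vfield \<Rightarrow> 'a vfield" where
  "app2 B X Y = (\<lambda>p. B p (X p) (Y p))"

definition linear_on_tangent ::
  "('a, 'e::euclidean_space) manifold \<Rightarrow> 'a \<Rightarrow> ('a tvec \<Rightarrow> 'a tvec) \<Rightarrow> bool" where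
  "linear_on_tangent M p k \<longleftrightarrow>
     (\<forall>x\<in>tangent_space M p. k x \<in> tangent_space M p) \<and>
     (\<forall>x\<in>tangent_space M p. \<forall>y\<in>tangent_space M p. k (x + y) = k x + k y) \<and>
     (\<forall>c. \<forall>x\<in>tangent_space M p. k (c *\<^sub>R x) = c *\<^sub>R k x)"

text \<open>Smoothness of a field of (multi)linear maps is expressed by its mapping smooth vector fields
  to smooth vector fields.\<close>

definition vector_1_form :: "('a, 'e::euclidean_space) manifold \<Rightarrow> 'a vform1 \<Rightarrow> bool" where
  "vector_1_form M K \<longleftrightarrow>
     (\<forall>p\<in>pts M. linear_on_tangent M p (K p)) \<and>
     (\<forall>X\<in>vector_fields M. K \<odot> X \<in> vector_fields M)"

definition vector_2_form :: "('a, 'e::euclidean_space) manifold \<Rightarrow> 'a vform2 \<Rightarrow> bool" where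
  "vector_2_form M B \<longleftrightarrow>
     (\<forall>p\<in>pts M. \<forall>x\<in>tangent_space M p. linear_on_tangent M p (B p x)) \<and>
     (\<forall>p\<in>pts M. \<forall>x\<in>tangent_space M p. \<forall>y\<in>tangent_space M p. B p x y = - B p y x) \<and>
     (\<forall>X\<in>vector_fields M. \<forall>Y\<in>vector_fields M. app2 B X Y \<in> vector_fields M)"

text \<open>The brackets are given by their values on vector fields: \<open>FN_01 X K Y\<close> is \<open>[X,K]Y\<close> and
  \<open>FN_11 K N X Y\<close> is \<open>[K,N](X,Y)\<close>.\<close>

definition FN_01 :: "'a vfield \<Rightarrow> 'a vform1 \<Rightarrow> 'a vfield \<Rightarrow> 'a vfield" where
  "FN_01 X K Y = lie_bracket X (K \<odot> Y) - K \<odot> lie_bracket X Y"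

definition FN_11 :: "'a vform1 \<Rightarrow> 'a vform1 \<Rightarrow> 'a vfield \<Rightarrow> 'a vfield \<Rightarrow> 'a vfield" where
  "FN_11 K N X Y =
     lie_bracket (K \<odot> X) (N \<odot> Y) + lie_bracket (N \<odot> X) (K \<odot> Y)
     + K \<odot> N \<odot> lie_bracket X Y + N \<odot> K \<odot> lie_bracket X Y
     - K \<odot> lie_bracket (N \<odot> X) Y - N \<odot> lie_bracket (K \<odot> X) Y
     - K \<odot> lie_bracket X (N \<odot> Y) - N \<odot> lie_bracket X (K \<odot> Y)"

definition i_form :: "'a vform1 \<Rightarrow> 'a vform2 \<Rightarrow> 'a vform2" where
  "i_form F B = (\<lambda>p x y. B p (F p x) y + B p x (F p y))"


section \<open>The structure \<open>L\<close>\<close>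

definition L_structure ::
  "('a, 'e::euclidean_space) manifold \<Rightarrow> nat \<Rightarrow> 'a vform1 \<Rightarrow> bool" where
  "L_structure M n L \<longleftrightarrow>
     vector_1_form M L \<and>
     (\<forall>z\<in>pts M. dim (L z ` tangent_space M z) = n) \<and>
     (\<forall>X\<in>vector_fields M. \<forall>Y\<in>vector_fields M. FN_11 L L X Y = 0) \<and>
     (\<forall>z\<in>pts M. L z ` tangent_space M z = {x \<in> tangent_space M z. L z x = 0})"

definition vertical_space ::
  "('a, 'e::euclidean_space) manifold \<Rightarrow> 'a vform1 \<Rightarrow> 'a \<Rightarrow> 'a tvec set" where
  "vertical_space M L z = L z ` tangent_space M z"

definition vertical_fields ::
  "('a, 'e::euclidean_space) manifold \<Rightarrow> 'a vform1 \<Rightarrow> 'a vfield set" where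
  "vertical_fields M L = {X \<in> vector_fields M. \<forall>z\<in>pts M. X z \<in> vertical_space M L z}"

definition canonical_field ::
  "('a, 'e::euclidean_space) manifold \<Rightarrow> 'a vform1 \<Rightarrow> 'a vfield \<Rightarrow> bool" where
  "canonical_field M L C \<longleftrightarrow>
     C \<in> vertical_fields M L \<and> (\<forall>Y\<in>vector_fields M. FN_01 C L Y = - (L \<odot> Y))"

definition L_semibasic ::
  "('a, 'e::euclidean_space) manifold \<Rightarrow> 'a vform1 \<Rightarrow> 'a vform2 \<Rightarrow> bool" where
  "L_semibasic M L B \<longleftrightarrow>
     (\<forall>p\<in>pts M. \<forall>x\<in>tangent_space M p. \<forall>y\<in>tangent_space M p. L p (B p x y) = 0) \<and>
     (\<forall>X\<in>vertical_fields M L. \<forall>p\<in>pts M. \<forall>y\<in>tangent_space M p. B p (X p) y = 0)"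

definition L_semispray ::
  "('a, 'e::euclidean_space) manifold \<Rightarrow> 'a vform1 \<Rightarrow> 'a vfield \<Rightarrow> 'a vfield \<Rightarrow> bool" where
  "L_semispray M L C S \<longleftrightarrow> S \<in> vector_fields M \<and> L \<odot> S = C"

text \<open>The choice of \<open>S\<close> is immaterial for semibasic \<open>B\<close>, since two semisprays differ by a
  vertical vector field.\<close>

definition potential ::
  "('a, 'e::euclidean_space) manifold \<Rightarrow> 'a vform1 \<Rightarrow> 'a vfield \<Rightarrow> 'a vform2 \<Rightarrow> 'a vform1" where
  "potential M L C B = (let S = (SOME S. L_semispray M L C S) in (\<lambda>p y. B p (S p) y))"


section \<open>\<open>L\<close>-connections\<close>

definition L_connection ::
  "('a, 'e::euclidean_space) manifold \<Rightarrow> 'a vform1 \<Rightarrow> 'a vform1 \<Rightarrow> bool" where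
  "L_connection M L \<Gamma> \<longleftrightarrow>
     vector_1_form M \<Gamma> \<and>
     (\<forall>p\<in>pts M. \<forall>x\<in>tangent_space M p. L p (\<Gamma> p x) = L p x \<and> \<Gamma> p (L p x) = - L p x)"

definition h_proj :: "'a vform1 \<Rightarrow> 'a vform1" where
  "h_proj \<Gamma> = (\<lambda>p x. (1/2) *\<^sub>R (x + \<Gamma> p x))"

definition L_torsion :: "'a vform1 \<Rightarrow> 'a vform1 \<Rightarrow> 'a vfield \<Rightarrow> 'a vfield \<Rightarrow> 'a vfield" where
  "L_torsion L \<Gamma> X Y = (1/2) *\<^sub>R FN_11 L \<Gamma> X Y"

definition L_curvature :: "'a vform1 \<Rightarrow> 'a vfield \<Rightarrow> 'a vfield \<Rightarrow> 'a vfield" where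
  "L_curvature \<Gamma> X Y = - ((1/2) *\<^sub>R FN_11 (h_proj \<Gamma>) (h_proj \<Gamma>) X Y)"

definition associated_almost_complex ::
  "('a, 'e::euclidean_space) manifold \<Rightarrow> 'a vform1 \<Rightarrow> 'a vform1 \<Rightarrow> 'a vform1 \<Rightarrow> bool" where
  "associated_almost_complex M L \<Gamma> F \<longleftrightarrow>
     vector_1_form M F \<and>
     (\<forall>p\<in>pts M. \<forall>x\<in>tangent_space M p.
        F p (L p x) = h_proj \<Gamma> p x \<and> F p (h_proj \<Gamma> p x) = - L p x)"


section \<open>Linear connections\<close>

text \<open>A linear connection is given as a covariant derivative \<open>D p x Y\<close> of a vector field \<open>Y\<close> in
  the direction of a tangent vector \<open>x\<close> at \<open>p\<close>.\<close>

type_synonym 'a connection = "'a \<Rightarrow> 'a tvec \<Rightarrow> 'a vfield \<Rightarrow> 'a tvec"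

definition cov :: "'a connection \<Rightarrow> 'a vfield \<Rightarrow> 'a vfield \<Rightarrow> 'a vfield" where
  "cov D X Y = (\<lambda>p. D p (X p) Y)"

definition linear_connection ::
  "('a, 'e::euclidean_space) manifold \<Rightarrow> 'a connection \<Rightarrow> bool" where
  "linear_connection M D \<longleftrightarrow>
     (\<forall>p\<in>pts M. \<forall>Y\<in>vector_fields M. linear_on_tangent M p (\<lambda>x. D p x Y)) \<and>
     (\<forall>p\<in>pts M. \<forall>x\<in>tangent_space M p. \<forall>Y\<in>vector_fields M. \<forall>Z\<in>vector_fields M.
        D p x (Y + Z) = D p x Y + D p x Z) \<and>
     (\<forall>p\<in>pts M. \<forall>x\<in>tangent_space M p. \<forall>f\<in>C_inf M. \<forall>Y\<in>vector_fields M.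
        D p x (\<lambda>q. f q *\<^sub>R Y q) = x f *\<^sub>R Y p + f p *\<^sub>R D p x Y) \<and>
     (\<forall>X\<in>vector_fields M. \<forall>Y\<in>vector_fields M. cov D X Y \<in> vector_fields M)"

definition connection_torsion :: "'a connection \<Rightarrow> 'a vfield \<Rightarrow> 'a vfield \<Rightarrow> 'a vfield" where
  "connection_torsion D X Y = cov D X Y - cov D Y X - lie_bracket X Y"

definition L_almost_tangent ::
  "('a, 'e::euclidean_space) manifold \<Rightarrow> 'a vform1 \<Rightarrow> 'a connection \<Rightarrow> bool" where
  "L_almost_tangent M L D \<longleftrightarrow>
     linear_connection M D \<and>
     (\<forall>p\<in>pts M. \<forall>x\<in>tangent_space M p. \<forall>Y\<in>vector_fields M. D p x (L \<odot> Y) = L p (D p x Y))"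

text \<open>The vector 1-form \<open>K(X) = D\<^sub>X C\<close>.\<close>

definition K_form :: "'a vfield \<Rightarrow> 'a connection \<Rightarrow> 'a vform1" where
  "K_form C D = (\<lambda>p x. D p x C)"

text \<open>Since \<open>K\<close> is fibrewise linear, it suffices to demand bijectivity on the vertical spaces.\<close>

definition L_regular ::
  "('a, 'e::euclidean_space) manifold \<Rightarrow> 'a vform1 \<Rightarrow> 'a vfield \<Rightarrow> 'a connection \<Rightarrow> bool" where
  "L_regular M L C D \<longleftrightarrow>
     L_almost_tangent M L D \<and>
     (\<forall>p\<in>pts M. bij_betw (K_form C D p) (vertical_space M L p) (vertical_space M L p))"

text \<open>\<open>\<Gamma>\<close> is the \<open>L\<close>-connection \<open>I - 2 \<phi> \<circ> K\<close> induced by \<open>D\<close>, where \<open>\<phi>\<close> is the inverse of \<open>K\<close> on the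
  vertical bundle.\<close>

definition induces ::
  "('a, 'e::euclidean_space) manifold \<Rightarrow> 'a vform1 \<Rightarrow> 'a vfield \<Rightarrow> 'a connection \<Rightarrow> 'a vform1 \<Rightarrow> bool"
  where
  "induces M L C D \<Gamma> \<longleftrightarrow>
     L_regular M L C D \<and> L_connection M L \<Gamma> \<and>
     (\<forall>p\<in>pts M. \<forall>x\<in>tangent_space M p.
        \<Gamma> p x = x - 2 *\<^sub>R inv_into (vertical_space M L p) (K_form C D p) (K_form C D p x))"

definition parallel ::
  "('a, 'e::euclidean_space) manifold \<Rightarrow> 'a connection \<Rightarrow> 'a vform1 \<Rightarrow> bool" where
  "parallel M D N \<longleftrightarrow>
     (\<forall>p\<in>pts M. \<forall>x\<in>tangent_space M p. \<forall>Y\<in>vector_fields M. D p x (N \<odot> Y) - N p (D p x Y) = 0)"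

definition reducible ::
  "('a, 'e::euclidean_space) manifold \<Rightarrow> 'a vform1 \<Rightarrow> 'a vfield \<Rightarrow> 'a connection \<Rightarrow> bool" where
  "reducible M L C D \<longleftrightarrow> (\<exists>\<Gamma>. induces M L C D \<Gamma> \<and> parallel M D \<Gamma>)"

definition L_normal ::
  "('a, 'e::euclidean_space) manifold \<Rightarrow> 'a vform1 \<Rightarrow> 'a vfield \<Rightarrow> 'a connection \<Rightarrow> bool" where
  "L_normal M L C D \<longleftrightarrow>
     L_almost_tangent M L D \<and>
     (\<forall>p\<in>pts M. \<forall>x\<in>tangent_space M p. D p (L p x) C = L p x)"

definition L_lift ::
  "('a, 'e::euclidean_space) manifold \<Rightarrow> 'a vform1 \<Rightarrow> 'a vfield \<Rightarrow> 'a vform1 \<Rightarrow> 'a connection \<Rightarrow> bool"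
  where
  "L_lift M L C \<Gamma> D \<longleftrightarrow> L_normal M L C D \<and> induces M L C D \<Gamma>"

definition reducible_L_lift ::
  "('a, 'e::euclidean_space) manifold \<Rightarrow> 'a vform1 \<Rightarrow> 'a vfield \<Rightarrow> 'a vform1 \<Rightarrow> 'a connection \<Rightarrow> bool"
  where
  "reducible_L_lift M L C \<Gamma> D \<longleftrightarrow> L_lift M L C \<Gamma> D \<and> reducible M L C D"

definition reducible_L_lift_for ::
  "('a, 'e::euclidean_space) manifold \<Rightarrow> 'a vform1 \<Rightarrow> 'a vfield \<Rightarrow> 'a vform1 \<Rightarrow> 'a vform2
     \<Rightarrow> 'a connection \<Rightarrow> bool" where
  "reducible_L_lift_for M L C \<Gamma> B D \<longleftrightarrow>
     reducible_L_lift M L C \<Gamma> D \<and>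
     (\<forall>X\<in>vector_fields M. \<forall>Y\<in>vector_fields M.
        connection_torsion D (L \<odot> X) Y = app2 B X Y)"

end

theory Submission
  imports Defs
begin

text \<open>Since \<open>D\<close> commutes with \<open>L\<close> and \<open>h\<close>, the rest is algebra over the additive group of vector fields.
  As \<open>L F = v\<close>, the torsion satisfies \<open>\<^bold>T(vX, Y) = B(FX, Y)\<close>, and so \<open>\<^bold>T(X, Y)\<close> is
  \<open>(i\<^sub>F B)(X, Y)\<close> plus \<open>\<^bold>T(hX, hY)\<close>. The vertical part of the latter is
  \<open>- v[hX, hY] = \<Omega>(X, Y)\<close>. Its image under \<open>L\<close> is \<open>D\<^bsub>hX\<^esub> LY - D\<^bsub>hY\<^esub> LX - L[hX, hY]\<close>; the covariant
  derivatives here are read off from the vertical part of \<open>\<^bold>T(LX, hY) = B(X, Y)\<close>, and the result is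
  \<open>T(X, Y) + 2 B(X, Y)\<close>. Applying \<open>F\<close> recovers the horizontal part because \<open>F L = h\<close>.\<close>

section \<open>Smooth functions\<close>

text \<open>\<open>Ck_on\<close> takes derivatives in the full space, so openness of
  \<open>S\<close> is what lets agreement on \<open>S\<close> pass to them. The sum and product
  rules below are known only at points of \<open>S\<close>, and this transfers them to the iterated
  derivatives.\<close>

lemma Ck_on_cong:
  assumes "open S" "\<And>x. x \<in> S \<Longrightarrow> f x = g x" "Ck_on k f S"
  shows "Ck_on k g S"
  using assms(2,3)
proof (induction k arbitrary: f g)
  case 0
  then show ?case by (simp cong: continuous_on_cong)
next
  case (Suc k)
  have der: "(g has_derivative frechet_derivative f (at x)) (at x)" if "x \<in> S" for x
    using Suc.prems that assms(1)
    by (intro has_derivative_transform_within_open[of f _ x UNIV S g])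
      (auto simp: frechet_derivative_works[symmetric])
  then have "frechet_derivative f (at x) = frechet_derivative g (at x)" if "x \<in> S" for x
    using frechet_derivative_at that by blast
  then have "Ck_on k (\<lambda>x. frechet_derivative g (at x) v) S" for v
    using Suc.IH[of "\<lambda>x. frechet_derivative f (at x) v" "\<lambda>x. frechet_derivative g (at x) v"] Suc.prems(2)
    by simp
  then show ?case
    using der by (auto simp: differentiable_def)
qed

text \<open>The product rule leaves one factor undifferentiated, and that factor must then be known
  to be \<open>Ck_on k\<close> as well.\<close>

lemma Ck_on_Suc_imp: "Ck_on (Suc k) f S \<Longrightarrow> Ck_on k f S"
proof (induction k arbitrary: f)
  case 0
  then show ?case
    by (auto intro!: continuous_at_imp_continuous_on differentiable_imp_continuous_within)
next
  case (Suc k)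
  then show ?case using Ck_on.simps(2) by blast
qed

lemma Ck_on_add:
  assumes "open S" "Ck_on k f S" "Ck_on k g S"
  shows "Ck_on k (\<lambda>x. f x + g x) S"
  using assms(2,3)
proof (induction k arbitrary: f g)
  case 0
  then show ?case by (simp add: continuous_on_add)
next
  case (Suc k)
  have der: "frechet_derivative (\<lambda>x. f x + g x) (at x)
      = (\<lambda>v. frechet_derivative f (at x) v + frechet_derivative g (at x) v)" if "x \<in> S" for x
    using Suc.prems that
    by (intro frechet_derivative_at[symmetric] has_derivative_add)
      (auto simp: frechet_derivative_works[symmetric])
  have "Ck_on k (\<lambda>x. frechet_derivative (\<lambda>x. f x + g x) (at x) v) S" for v
    by (rule Ck_on_cong[OF assms(1) _ Suc.IH])
      (use Suc.prems der in auto)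
  then show ?case using Suc.prems by (auto intro: differentiable_add)
qed

lemma Ck_on_mult:
  fixes f g :: "'e::euclidean_space \<Rightarrow> real"
  assumes "open S" "Ck_on k f S" "Ck_on k g S"
  shows "Ck_on k (\<lambda>x. f x * g x) S"
  using assms(2,3)
proof (induction k arbitrary: f g)
  case 0
  then show ?case by (simp add: continuous_on_mult)
next
  case (Suc k)
  have der: "frechet_derivative (\<lambda>x. f x * g x) (at x)
      = (\<lambda>v. f x * frechet_derivative g (at x) v + frechet_derivative f (at x) v * g x)"
    if "x \<in> S" for x
    using Suc.prems that
    by (intro frechet_derivative_at[symmetric] has_derivative_mult)
      (auto simp: frechet_derivative_works[symmetric])
  have "Ck_on k (\<lambda>x. frechet_derivative (\<lambda>x. f x * g x) (at x) v) S" for v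
    by (rule Ck_on_cong[OF assms(1) _ Ck_on_add[OF assms(1) Suc.IH Suc.IH]])
      (use Suc.prems der Ck_on_Suc_imp in auto)
  then show ?case using Suc.prems by (auto intro: differentiable_mult)
qed

lemma Ck_on_const: "Ck_on k (\<lambda>x. c) S"
  by (induction k arbitrary: c) (simp_all add: frechet_derivative_const)

lemma smooth_manifold_open_chart:
  "smooth_manifold M \<Longrightarrow> (U, \<phi>) \<in> charts M \<Longrightarrow> open (\<phi> ` U)"
  unfolding smooth_manifold_def by fast

lemma C_inf_add:
  assumes "smooth_manifold M" "f \<in> C_inf M" "g \<in> C_inf M"
  shows "f + g \<in> C_inf M"
  using assms smooth_manifold_open_chart[OF assms(1)]
  by (fastforce simp: C_inf_def smooth_on_def intro!: Ck_on_add)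

lemma C_inf_mult:
  assumes "smooth_manifold M" "f \<in> C_inf M" "g \<in> C_inf M"
  shows "f * g \<in> C_inf M"
  using assms smooth_manifold_open_chart[OF assms(1)]
  by (fastforce simp: C_inf_def smooth_on_def intro!: Ck_on_mult)

lemma C_inf_scaleR:
  assumes "smooth_manifold M" "f \<in> C_inf M"
  shows "c *\<^sub>R f \<in> C_inf M"
  using assms smooth_manifold_open_chart[OF assms(1)]
  by (fastforce simp: C_inf_def smooth_on_def scaleR_fun_def intro!: Ck_on_mult Ck_on_const)

lemma C_inf_zero: "0 \<in> C_inf M"
  by (auto simp: C_inf_def smooth_on_def Ck_on_const)

section \<open>Vector fields and the Lie bracket\<close>

lemma subspace_tangent_space:
  "subspace (tangent_space M p)"
  unfolding subspace_def tangent_space_def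
  by (auto simp: scaleR_fun_def algebra_simps)

lemma tangent_zero: "v \<in> tangent_space M p \<Longrightarrow> v 0 = 0"
  using C_inf_zero[of M] unfolding tangent_space_def
  by (metis (mono_tags, lifting) add_cancel_right_right mem_Collect_eq)

lemma vector_field_tangent: "X \<in> vector_fields M \<Longrightarrow> p \<in> pts M \<Longrightarrow> X p \<in> tangent_space M p"
  by (simp add: vector_fields_def)

lemma vector_field_outside: "X \<in> vector_fields M \<Longrightarrow> p \<notin> pts M \<Longrightarrow> X p = 0"
  by (simp add: vector_fields_def)

lemma vector_field_C_inf: "X \<in> vector_fields M \<Longrightarrow> f \<in> C_inf M \<Longrightarrow> (\<lambda>p. X p f) \<in> C_inf M"
  by (simp add: vector_fields_def)

lemma vector_field_not_C_inf: "X \<in> vector_fields M \<Longrightarrow> f \<notin> C_inf M \<Longrightarrow> X p f = 0"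
  by (cases "p \<in> pts M") (auto simp: vector_fields_def tangent_space_def)

text \<open>Outside the manifold the field is zero, so this law and the next two hold at every
  \<open>p\<close> and can be applied inside functions such as
  \<open>\<lambda>q. X q f\<close>.\<close>

lemma vector_field_add:
  "X \<in> vector_fields M \<Longrightarrow> f \<in> C_inf M \<Longrightarrow> g \<in> C_inf M \<Longrightarrow> X p (f + g) = X p f + X p g"
  by (cases "p \<in> pts M") (auto simp: vector_fields_def tangent_space_def)

lemma vector_field_scaleR:
  "X \<in> vector_fields M \<Longrightarrow> f \<in> C_inf M \<Longrightarrow> X p (c *\<^sub>R f) = c * X p f"
  by (cases "p \<in> pts M") (auto simp: vector_fields_def tangent_space_def)

lemma vector_field_mult:
  "X \<in> vector_fields M \<Longrightarrow> f \<in> C_inf M \<Longrightarrow> g \<in> C_inf M \<Longrightarrow> X p (f * g) = f p * X p g + g p * X p f"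
  by (cases "p \<in> pts M") (auto simp: vector_fields_def tangent_space_def)

text \<open>Needed for brackets on a non-smooth \<open>f\<close>: there
  \<open>\<lambda>q. Y q f\<close> is the zero function, to which \<open>X p\<close> is then
  applied.\<close>

lemma vector_field_zero: "X \<in> vector_fields M \<Longrightarrow> X p 0 = 0"
  by (cases "p \<in> pts M") (auto simp: vector_field_outside intro: tangent_zero vector_field_tangent)

lemma vector_fields_eqI:
  assumes "X \<in> vector_fields M" "Y \<in> vector_fields M" "\<And>p. p \<in> pts M \<Longrightarrow> X p = Y p"
  shows "X = Y"
  using assms by (auto simp: vector_fields_def fun_eq_iff) metis

lemma subspace_vector_fields:
  assumes "smooth_manifold M"
  shows "subspace (vector_fields M)"
proof -
  have "(\<lambda>p. X p f + Y p f) \<in> C_inf M"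
    if "X \<in> vector_fields M" "Y \<in> vector_fields M" "f \<in> C_inf M" for X Y f
    using C_inf_add[OF assms vector_field_C_inf vector_field_C_inf] that by (simp add: plus_fun_def)
  moreover have "(\<lambda>p. c * X p f) \<in> C_inf M"
    if "X \<in> vector_fields M" "f \<in> C_inf M" for X f c
    using C_inf_scaleR[OF assms vector_field_C_inf] that by (simp add: scaleR_fun_def)
  moreover have "(\<lambda>p. 0) \<in> C_inf M"
    using C_inf_zero[of M] by (simp add: zero_fun_def)
  ultimately show ?thesis
    unfolding subspace_def
    by (auto simp: vector_fields_def scaleR_fun_def subspace_0[OF subspace_tangent_space]
        subspace_add[OF subspace_tangent_space]
        subspace_scale[OF subspace_tangent_space, unfolded scaleR_fun_def real_scaleR_def])
qed

lemma lie_bracket_skew: "lie_bracket X Y = - lie_bracket Y X"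
  by (simp add: lie_bracket_def fun_eq_iff)

lemma lie_bracket_add_right:
  assumes "X \<in> vector_fields M" "Y \<in> vector_fields M" "Z \<in> vector_fields M"
  shows "lie_bracket X (Y + Z) = lie_bracket X Y + lie_bracket X Z"
proof (intro ext)
  fix p f
  have "X p (\<lambda>q. Y q f + Z q f) = X p (\<lambda>q. Y q f) + X p (\<lambda>q. Z q f)"
  proof (cases "f \<in> C_inf M")
    case True
    then show ?thesis
      using vector_field_add[OF assms(1) vector_field_C_inf vector_field_C_inf] assms
      by (simp add: plus_fun_def)
  next
    case False
    then show ?thesis
      using assms vector_field_zero[OF assms(1), unfolded zero_fun_def]
      by (simp add: vector_field_not_C_inf)
  qed
  then show "lie_bracket X (Y + Z) p f = (lie_bracket X Y + lie_bracket X Z) p f"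
    by (simp add: lie_bracket_def)
qed

text \<open>Each composite of two fields violates the Leibniz rule by the products of first
  derivatives seen in \<open>mult\<close>. These are symmetric in the two fields and cancel in the
  commutator.\<close>

lemma lie_bracket_vector_field:
  assumes M: "smooth_manifold M" and X: "X \<in> vector_fields M" and Y: "Y \<in> vector_fields M"
  shows "lie_bracket X Y \<in> vector_fields M"
proof -
  have C: "(\<lambda>p. Z p f) \<in> C_inf M" if "Z \<in> vector_fields M" "f \<in> C_inf M" for Z f
    using that by (rule vector_field_C_inf)
  have add: "W p (\<lambda>q. Z q (f + g)) = W p (\<lambda>q. Z q f) + W p (\<lambda>q. Z q g)"
    if "W \<in> vector_fields M" "Z \<in> vector_fields M" "f \<in> C_inf M" "g \<in> C_inf M" for W Z f g p
  proof -
    have "(\<lambda>q. Z q (f + g)) = (\<lambda>q. Z q f) + (\<lambda>q. Z q g)"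
      using that by (simp add: vector_field_add fun_eq_iff)
    then show ?thesis using that by (simp only: vector_field_add C)
  qed
  have scale: "W p (\<lambda>q. Z q (c *\<^sub>R f)) = c * W p (\<lambda>q. Z q f)"
    if "W \<in> vector_fields M" "Z \<in> vector_fields M" "f \<in> C_inf M" for W Z f c p
  proof -
    have "(\<lambda>q. Z q (c *\<^sub>R f)) = c *\<^sub>R (\<lambda>q. Z q f)"
      using that by (intro ext) (simp add: vector_field_scaleR, simp add: scaleR_fun_def)
    then show ?thesis using that by (simp only: vector_field_scaleR C)
  qed
  have mult: "W p (\<lambda>q. Z q (f * g)) = f p * W p (\<lambda>q. Z q g) + Z p g * W p f
      + (g p * W p (\<lambda>q. Z q f) + Z p f * W p g)"
    if "W \<in> vector_fields M" "Z \<in> vector_fields M" "f \<in> C_inf M" "g \<in> C_inf M" for W Z f g p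
  proof -
    have "(\<lambda>q. Z q (f * g)) = f * (\<lambda>q. Z q g) + g * (\<lambda>q. Z q f)"
      using that by (simp add: vector_field_mult fun_eq_iff)
    then show ?thesis
      using that by (simp only: vector_field_add vector_field_mult C C_inf_mult[OF M])
  qed
  have out: "lie_bracket X Y p f = 0" if "f \<notin> C_inf M" for p f
    using that X Y vector_field_zero[OF X, unfolded zero_fun_def]
      vector_field_zero[OF Y, unfolded zero_fun_def]
    by (simp add: lie_bracket_def vector_field_not_C_inf)
  have "lie_bracket X Y p \<in> tangent_space M p" for p
    unfolding tangent_space_def
    using X Y out
    by (auto simp: lie_bracket_def add scale mult algebra_simps)
  moreover have "(\<lambda>p. lie_bracket X Y p f) \<in> C_inf M" if "f \<in> C_inf M" for f
  proof -
    have "(\<lambda>p. X p (\<lambda>q. Y q f)) + (-1) *\<^sub>R (\<lambda>p. Y p (\<lambda>q. X q f)) \<in> C_inf M"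
      by (rule C_inf_add[OF M C[OF X C[OF Y that]] C_inf_scaleR[OF M C[OF Y C[OF X that]]]])
    then show ?thesis by (simp add: lie_bracket_def plus_fun_def scaleR_fun_def)
  qed
  moreover have "lie_bracket X Y p = 0" if "p \<notin> pts M" for p
    using that X Y by (simp add: lie_bracket_def vector_field_outside fun_eq_iff)
  ultimately show ?thesis by (simp add: vector_fields_def)
qed

section \<open>Algebra of reducible lifts\<close>

text \<open>Forms are required to be linear on tangent vectors only, so their laws are stated on a
  subspace \<open>V\<close>. Additivity is what forms, Lie brackets and covariant derivatives have
  in common in every argument.\<close>

locale additive_on =
  fixes V :: "'v::real_vector set" and f :: "'v \<Rightarrow> 'v"
  assumes subspace: "subspace V"
    and closed [simp]: "X \<in> V \<Longrightarrow> f X \<in> V"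
    and add [simp]: "X \<in> V \<Longrightarrow> Y \<in> V \<Longrightarrow> f (X + Y) = f X + f Y"
begin

lemma zero [simp]: "f 0 = 0"
  using add[of 0 0] subspace_0[OF subspace] by simp

lemma minus [simp]: "X \<in> V \<Longrightarrow> f (- X) = - f X"
  using add[of X "- X"] subspace_neg[OF subspace] by (simp add: minus_unique)

lemma diff [simp]: "X \<in> V \<Longrightarrow> Y \<in> V \<Longrightarrow> f (X - Y) = f X - f Y"
  using add[of X "- Y"] subspace_neg[OF subspace] by simp

end

text \<open>To be instantiated with the vector fields as \<open>V\<close>, the Lie bracket as
  \<open>br\<close> and the covariant derivative as \<open>D\<close>. The law \<open>br_LL\<close>
  is the involutivity of the vertical bundle, and \<open>torsion_L\<close> is the condition that
  selects the lift.\<close>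

locale reducible_lift_algebra =
  L: additive_on V L + h: additive_on V h + F: additive_on V F
  for V :: "'v::real_vector set" and L h F +
  fixes br B D :: "'v \<Rightarrow> 'v \<Rightarrow> 'v"
  assumes br_additive: "X \<in> V \<Longrightarrow> additive_on V (br X)"
    and br_skew: "br X Y = - br Y X"
    and B_additive: "X \<in> V \<Longrightarrow> additive_on V (B X)"
    and B_skew: "X \<in> V \<Longrightarrow> Y \<in> V \<Longrightarrow> B X Y = - B Y X"
    and D_additive_left: "Y \<in> V \<Longrightarrow> additive_on V (\<lambda>X. D X Y)"
    and D_additive_right: "X \<in> V \<Longrightarrow> additive_on V (D X)"
    and LL [simp]: "X \<in> V \<Longrightarrow> L (L X) = 0"
    and Lh [simp]: "X \<in> V \<Longrightarrow> L (h X) = L X"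
    and hL [simp]: "X \<in> V \<Longrightarrow> h (L X) = 0"
    and FL [simp]: "X \<in> V \<Longrightarrow> F (L X) = h X"
    and LF: "X \<in> V \<Longrightarrow> L (F X) = X - h X"
    and br_LL: "X \<in> V \<Longrightarrow> Y \<in> V \<Longrightarrow> L (br (L X) (L Y)) = 0"
    and LB [simp]: "X \<in> V \<Longrightarrow> Y \<in> V \<Longrightarrow> L (B X Y) = 0"
    and BL: "X \<in> V \<Longrightarrow> Y \<in> V \<Longrightarrow> B (L X) Y = 0"
    and DL: "X \<in> V \<Longrightarrow> Y \<in> V \<Longrightarrow> D X (L Y) = L (D X Y)"
    and Dh: "X \<in> V \<Longrightarrow> Y \<in> V \<Longrightarrow> D X (h Y) = h (D X Y)"
    and torsion_L: "X \<in> V \<Longrightarrow> Y \<in> V \<Longrightarrow> D (L X) Y - D Y (L X) - br (L X) Y = B X Y"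
begin

definition torsion where "torsion X Y = D X Y - D Y X - br X Y"

definition v where "v X = X - h X"

lemma V_closed [simp]:
  "X \<in> V \<Longrightarrow> Y \<in> V \<Longrightarrow> X + Y \<in> V"
  "X \<in> V \<Longrightarrow> - X \<in> V"
  "X \<in> V \<Longrightarrow> Y \<in> V \<Longrightarrow> X - Y \<in> V"
  "X \<in> V \<Longrightarrow> v X \<in> V"
  by (auto simp: v_def subspace_add subspace_neg subspace_diff L.subspace)

lemma br_closed [simp]: "X \<in> V \<Longrightarrow> Y \<in> V \<Longrightarrow> br X Y \<in> V"
  by (rule additive_on.closed[OF br_additive])

lemma B_closed [simp]: "X \<in> V \<Longrightarrow> Y \<in> V \<Longrightarrow> B X Y \<in> V"
  by (rule additive_on.closed[OF B_additive])

lemma D_closed [simp]: "X \<in> V \<Longrightarrow> Y \<in> V \<Longrightarrow> D X Y \<in> V"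
  by (rule additive_on.closed[OF D_additive_right])

lemma br_diff_right: "X \<in> V \<Longrightarrow> Y \<in> V \<Longrightarrow> Z \<in> V \<Longrightarrow> br X (Y - Z) = br X Y - br X Z"
  by (rule additive_on.diff[OF br_additive])

lemma br_diff_left: "X \<in> V \<Longrightarrow> Y \<in> V \<Longrightarrow> Z \<in> V \<Longrightarrow> br (X - Y) Z = br X Z - br Y Z"
  using br_diff_right[of Z X Y] br_skew[of "X - Y" Z] br_skew[of X Z] br_skew[of Y Z] by simp

lemma torsion_add_right:
  "X \<in> V \<Longrightarrow> Y \<in> V \<Longrightarrow> Z \<in> V \<Longrightarrow> torsion X (Y + Z) = torsion X Y + torsion X Z"
  using additive_on.add[OF br_additive] additive_on.add[OF D_additive_right]
    additive_on.add[OF D_additive_left]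
  by (simp add: torsion_def)

lemma torsion_skew: "torsion X Y = - torsion Y X"
  using br_skew[of X Y] by (simp add: torsion_def)

lemma torsion_add_left:
  "X \<in> V \<Longrightarrow> Y \<in> V \<Longrightarrow> Z \<in> V \<Longrightarrow> torsion (X + Y) Z = torsion X Z + torsion Y Z"
  using torsion_add_right[of Z X Y]
    torsion_skew[of "X + Y" Z] torsion_skew[of X Z] torsion_skew[of Y Z] by simp

section \<open>Vertical fields and semibasic arguments\<close>

lemma hh [simp]: "X \<in> V \<Longrightarrow> h (h X) = h X"
  using FL[of "h X"] FL[of X] Lh[of X] by simp

lemma Lv [simp]: "X \<in> V \<Longrightarrow> L (v X) = 0"
  by (simp add: v_def)

lemma h_of_vertical: "X \<in> V \<Longrightarrow> L X = 0 \<Longrightarrow> h X = 0"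
  using FL[of X] by simp

text \<open>An explicit preimage under \<open>L\<close>: the kernel of \<open>L\<close> on
  \<open>V\<close> is its image. Laws stated for fields \<open>L X\<close> thereby extend to all
  vertical fields.\<close>

lemma vertical_eq: "X \<in> V \<Longrightarrow> L X = 0 \<Longrightarrow> L (F X) = X"
  by (simp add: LF h_of_vertical)

lemma br_vertical:
  "X \<in> V \<Longrightarrow> Y \<in> V \<Longrightarrow> L X = 0 \<Longrightarrow> L Y = 0 \<Longrightarrow> L (br X Y) = 0"
  using br_LL[of "F X" "F Y"] by (simp add: vertical_eq)

lemma B_vertical_left: "X \<in> V \<Longrightarrow> Y \<in> V \<Longrightarrow> L X = 0 \<Longrightarrow> B X Y = 0"
  using BL[of "F X" Y] by (simp add: vertical_eq)

lemma B_vertical_right: "X \<in> V \<Longrightarrow> Y \<in> V \<Longrightarrow> L Y = 0 \<Longrightarrow> B X Y = 0"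
  using B_vertical_left[of Y X] B_skew[of X Y] by simp

lemma B_h_right: "X \<in> V \<Longrightarrow> Y \<in> V \<Longrightarrow> B X (h Y) = B X Y"
  using B_vertical_right[of X "v Y"] additive_on.diff[OF B_additive, of X Y "h Y"]
  by (simp add: v_def)

section \<open>Torsion on vertical and horizontal arguments\<close>

lemma torsion_vertical: "X \<in> V \<Longrightarrow> Y \<in> V \<Longrightarrow> torsion (v X) Y = B (F X) Y"
  \<comment> \<open>The vertical part of \<open>X\<close> is \<open>L (F X)\<close> by
    \<open>LF\<close>, so the law for \<open>L\<close> applies with \<open>F X\<close> in place of
    \<open>X\<close>.\<close>
  using torsion_L[of "F X" Y] by (simp add: torsion_def v_def LF)

lemma torsion_decomposition:
  assumes "X \<in> V" "Y \<in> V"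
  shows "torsion X Y = torsion (h X) (h Y) + (B (F X) Y + B X (F Y))"
proof -
  have "torsion X Y = torsion (v X + h X) Y" by (simp add: v_def)
  also have "\<dots> = B (F X) Y + torsion (h X) Y"
    using assms torsion_add_left[of "v X" "h X" Y] torsion_vertical[of X Y] by simp
  also have "torsion (h X) Y = torsion (h X) (v Y + h Y)" by (simp add: v_def)
  also have "\<dots> = torsion (h X) (v Y) + torsion (h X) (h Y)"
    using assms by (simp add: torsion_add_right)
  \<comment> \<open>Skewness is used twice, for the torsion and for \<open>B\<close>, so the signs
    cancel. In between, \<open>h X\<close> is replaced by \<open>X\<close> because \<open>B\<close>
    is semibasic.\<close>
  also have "torsion (h X) (v Y) = B X (F Y)"
    using assms torsion_skew[of "h X" "v Y"] torsion_vertical[of Y "h X"] B_h_right[of "F Y" X]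
      B_skew[of "F Y" X] by simp
  finally show ?thesis by simp
qed

text \<open>Commutation of \<open>D\<close> with \<open>L\<close> and \<open>h\<close> makes
  \<open>D (h Y) (L X)\<close> vertical and \<open>D (L X) (h Y)\<close> horizontal. The horizontal
  part of the torsion law at \<open>L X\<close>, \<open>h Y\<close> therefore determines the second
  derivative as \<open>h (br (L X) (h Y))\<close>, and the law itself then gives the first.\<close>

lemma D_horizontal_vertical:
  assumes "X \<in> V" "Y \<in> V"
  shows "D (h Y) (L X) = - B X Y - v (br (L X) (h Y))"
proof -
  let ?R = "D (L X) (h Y) - D (h Y) (L X) - br (L X) (h Y)"
  have "B X Y = ?R"
    using torsion_L[of X "h Y"] assms B_h_right by simp
  moreover have "h (B X Y) = 0" using assms by (simp add: h_of_vertical)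
  moreover have "h (D (h Y) (L X)) = 0" using assms by (simp add: DL)
  moreover have "h (D (L X) (h Y)) = D (L X) (h Y)" using assms by (simp add: Dh)
  moreover have "h ?R = h (D (L X) (h Y)) - h (D (h Y) (L X)) - h (br (L X) (h Y))"
    using assms by simp
  ultimately have "D (L X) (h Y) = h (br (L X) (h Y))" by simp
  with \<open>B X Y = ?R\<close> show ?thesis by (simp add: v_def)
qed

text \<open>The torsion \<open>T\<close> of the \<Gamma> at hand, in the shape in which it arises
  from the horizontal torsion of \<open>D\<close>. Its agreement with the value of the bracket
  [L, h] is \<open>weak_torsion_eq\<close>.\<close>

definition weak_torsion where
  "weak_torsion X Y = v (br (L X) (h Y)) + v (br (h X) (L Y)) - L (br (h X) (h Y))"

lemma weak_torsion_closed [simp]: "X \<in> V \<Longrightarrow> Y \<in> V \<Longrightarrow> weak_torsion X Y \<in> V"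
  by (simp add: weak_torsion_def)

text \<open>The two copies of \<open>B X Y\<close> have different sources:
  \<open>D (h X) (L Y)\<close> contributes \<open>- B Y X = B X Y\<close>, and
  \<open>- D (h Y) (L X)\<close> contributes \<open>B X Y\<close>.\<close>

lemma L_torsion_horizontal:
  assumes "X \<in> V" "Y \<in> V"
  shows "L (torsion (h X) (h Y)) = weak_torsion X Y + (B X Y + B X Y)"
proof -
  have "L (torsion (h X) (h Y)) = D (h X) (L Y) - D (h Y) (L X) - L (br (h X) (h Y))"
    using assms by (simp add: torsion_def DL Dh)
  moreover have "v (br (L Y) (h X)) = - v (br (h X) (L Y))"
    using br_skew[of "L Y" "h X"] assms by (simp add: v_def)
  ultimately show ?thesis
    using D_horizontal_vertical[of X Y] D_horizontal_vertical[of Y X] B_skew[of Y X] assms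
    by (simp add: weak_torsion_def)
qed

text \<open>Both covariant derivatives of horizontal fields are again horizontal by
  \<open>Dh\<close>, so \<open>v\<close> leaves only the bracket.\<close>

lemma v_torsion_horizontal:
  assumes "X \<in> V" "Y \<in> V"
  shows "v (torsion (h X) (h Y)) = - v (br (h X) (h Y))"
  using assms by (simp add: torsion_def v_def Dh)

lemma torsion_formula:
  assumes "X \<in> V" "Y \<in> V"
  shows "torsion X Y = F (weak_torsion X Y) - v (br (h X) (h Y)) + (B (F X) Y + B X (F Y))
    + (F (B X Y) + F (B X Y))"
proof -
  let ?Z = "torsion (h X) (h Y)"
  have "?Z \<in> V" using assms by (simp add: torsion_def)
  then have "?Z = F (L ?Z) + v ?Z" by (simp add: v_def)
  then show ?thesis
    using assms torsion_decomposition[of X Y] v_torsion_horizontal[of X Y]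
    by (simp add: L_torsion_horizontal)
qed

text \<open>The next two identities come down to the bracket of two vertical fields being vertical.\<close>

lemma curvature_eq:
  assumes "X \<in> V" "Y \<in> V"
  shows "br (h X) (h Y) + h (br X Y) - h (br (h X) Y) - h (br X (h Y)) = v (br (h X) (h Y))"
proof -
  have "h (br (v X) (v Y)) = 0"
    using assms by (simp add: h_of_vertical br_vertical)
  then have "h (br X Y) - h (br X (h Y)) - h (br (h X) Y) + h (br (h X) (h Y)) = 0"
    using assms by (simp add: v_def br_diff_left br_diff_right algebra_simps)
  then show ?thesis by (simp add: v_def algebra_simps)
qed

lemma weak_torsion_eq:
  assumes "X \<in> V" "Y \<in> V"
  shows "br (L X) (h Y) + br (h X) (L Y) + L (br X Y) - L (br (h X) Y) - h (br (L X) Y)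
     - L (br X (h Y)) - h (br X (L Y)) = weak_torsion X Y"
proof -
  \<comment> \<open>The first identity turns the three \<open>L\<close> terms of the bracket into
    \<open>- L (br (h X) (h Y))\<close>. The other two put \<open>h Y\<close> and \<open>h X\<close>
    into the \<open>h\<close> terms, which then combine with the leading brackets to their
    \<open>v\<close> parts.\<close>
  have "L (br (v X) (v Y)) = 0" "h (br (L X) (v Y)) = 0" "h (br (v X) (L Y)) = 0"
    using assms by (simp_all add: h_of_vertical br_vertical)
  then have "L (br X Y) - L (br X (h Y)) - L (br (h X) Y) + L (br (h X) (h Y)) = 0"
    "h (br (L X) Y) = h (br (L X) (h Y))" "h (br X (L Y)) = h (br (h X) (L Y))"
    using assms by (simp_all add: v_def br_diff_left br_diff_right algebra_simps)
  then show ?thesis by (simp add: weak_torsion_def v_def algebra_simps)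
qed

end

section \<open>Forms and connections as operators on vector fields\<close>

lemma app1_apply: "(K \<odot> X) p = K p (X p)"
  by (simp add: app1_def)

lemma vector_1_form_additive:
  assumes M: "smooth_manifold M" and K: "vector_1_form M K"
  shows "additive_on (vector_fields M) (\<lambda>X. K \<odot> X)"
proof
  show sub: "subspace (vector_fields M)" by (rule subspace_vector_fields[OF M])
  show cl: "K \<odot> X \<in> vector_fields M" if "X \<in> vector_fields M" for X
    using K that by (simp add: vector_1_form_def)
  show "K \<odot> (X + Y) = K \<odot> X + K \<odot> Y" if "X \<in> vector_fields M" "Y \<in> vector_fields M" for X Y
    using K that sub
    by (intro vector_fields_eqI[of _ M] cl subspace_add[OF sub])
      (auto simp: app1_def vector_1_form_def linear_on_tangent_def vector_field_tangent)
qed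

lemma vector_2_form_linear:
  "vector_2_form M B \<Longrightarrow> p \<in> pts M \<Longrightarrow> x \<in> tangent_space M p \<Longrightarrow> linear_on_tangent M p (B p x)"
  by (simp only: vector_2_form_def)

lemma vector_2_form_closed:
  "vector_2_form M B \<Longrightarrow> X \<in> vector_fields M \<Longrightarrow> Y \<in> vector_fields M \<Longrightarrow> app2 B X Y \<in> vector_fields M"
  by (simp only: vector_2_form_def)

lemma vector_2_form_additive:
  assumes M: "smooth_manifold M" and B: "vector_2_form M B" and X: "X \<in> vector_fields M"
  shows "additive_on (vector_fields M) (app2 B X)"
proof
  show sub: "subspace (vector_fields M)" by (rule subspace_vector_fields[OF M])
  show cl: "app2 B X Y \<in> vector_fields M" if "Y \<in> vector_fields M" for Y
    using B X that by (rule vector_2_form_closed)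
  show "app2 B X (Y + Z) = app2 B X Y + app2 B X Z"
    if "Y \<in> vector_fields M" "Z \<in> vector_fields M" for Y Z
    using B X that sub
    by (intro vector_fields_eqI[of _ M] cl subspace_add[OF sub])
      (use vector_2_form_linear[OF B] in
        \<open>auto simp: app2_def linear_on_tangent_def vector_field_tangent\<close>)
qed

lemma vector_2_form_skew:
  assumes B: "vector_2_form M B" and X: "X \<in> vector_fields M" "Y \<in> vector_fields M"
    and M: "smooth_manifold M"
  shows "app2 B X Y = - app2 B Y X"
proof (rule vector_fields_eqI)
  show "app2 B X Y \<in> vector_fields M" "- app2 B Y X \<in> vector_fields M"
    using assms by (auto intro: vector_2_form_closed subspace_neg[OF subspace_vector_fields])
  have "B p (X p) (Y p) = - B p (Y p) (X p)" if "p \<in> pts M" for p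
    using B X[THEN vector_field_tangent, OF that] that unfolding vector_2_form_def by blast
  then show "app2 B X Y p = (- app2 B Y X) p" if "p \<in> pts M" for p
    using that by (simp add: app2_def)
qed

lemma lie_bracket_additive:
  assumes M: "smooth_manifold M" and X: "X \<in> vector_fields M"
  shows "additive_on (vector_fields M) (lie_bracket X)"
  by standard (use assms in \<open>auto simp: subspace_vector_fields lie_bracket_vector_field
      intro: lie_bracket_add_right\<close>)

section \<open>Covariant derivatives as biadditive operators\<close>

lemma cov_closed:
  "linear_connection M D \<Longrightarrow> X \<in> vector_fields M \<Longrightarrow> Y \<in> vector_fields M \<Longrightarrow>
    cov D X Y \<in> vector_fields M"
  by (simp add: linear_connection_def)

lemma cov_additive_left:
  assumes M: "smooth_manifold M" and D: "linear_connection M D" and Y: "Y \<in> vector_fields M"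
  shows "additive_on (vector_fields M) (\<lambda>X. cov D X Y)"
proof
  show sub: "subspace (vector_fields M)" by (rule subspace_vector_fields[OF M])
  show cl: "cov D X Y \<in> vector_fields M" if "X \<in> vector_fields M" for X
    using D Y that by (simp add: cov_closed)
  show "cov D (X + Z) Y = cov D X Y + cov D Z Y"
    if "X \<in> vector_fields M" "Z \<in> vector_fields M" for X Z
    using D Y that sub
    by (intro vector_fields_eqI[of _ M] cl subspace_add[OF sub])
      (auto simp: cov_def linear_connection_def linear_on_tangent_def vector_field_tangent)
qed

lemma cov_additive_right:
  assumes M: "smooth_manifold M" and D: "linear_connection M D" and X: "X \<in> vector_fields M"
  shows "additive_on (vector_fields M) (cov D X)"
proof
  show sub: "subspace (vector_fields M)" by (rule subspace_vector_fields[OF M])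
  show cl: "cov D X Y \<in> vector_fields M" if "Y \<in> vector_fields M" for Y
    using D X that by (simp add: cov_closed)
  show "cov D X (Y + Z) = cov D X Y + cov D X Z"
    if "Y \<in> vector_fields M" "Z \<in> vector_fields M" for Y Z
    using D X that sub
    by (intro vector_fields_eqI[of _ M] cl subspace_add[OF sub])
      (auto simp: cov_def linear_connection_def vector_field_tangent)
qed

lemma cov_parallel:
  assumes D: "linear_connection M D" and N: "vector_1_form M N" "parallel M D N"
    and X: "X \<in> vector_fields M" "Y \<in> vector_fields M"
  shows "cov D X (N \<odot> Y) = N \<odot> cov D X Y"
  using assms
  by (intro vector_fields_eqI[of _ M])
    (auto simp: cov_def app1_def vector_1_form_def linear_connection_def parallel_def
      vector_field_tangent)

lemma h_proj_app: "h_proj \<Gamma> \<odot> X = (1/2) *\<^sub>R (X + \<Gamma> \<odot> X)"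
  by (simp add: h_proj_def app1_def fun_eq_iff scaleR_fun_def)

lemma h_proj_vector_1_form:
  assumes M: "smooth_manifold M" and G: "vector_1_form M \<Gamma>"
  shows "vector_1_form M (h_proj \<Gamma>)"
  unfolding vector_1_form_def
proof (intro conjI ballI)
  fix p assume p: "p \<in> pts M"
  let ?T = "tangent_space M p"
  have G: "\<Gamma> p x \<in> ?T" "\<Gamma> p (x + y) = \<Gamma> p x + \<Gamma> p y" "\<Gamma> p (c *\<^sub>R x) = c *\<^sub>R \<Gamma> p x"
    if "x \<in> ?T" "y \<in> ?T" for x y c
    using G p that by (auto simp: vector_1_form_def linear_on_tangent_def)
  then show "linear_on_tangent M p (h_proj \<Gamma> p)"
    unfolding linear_on_tangent_def h_proj_def
    using subspace_add[OF subspace_tangent_space[of M p]]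
      subspace_scale[OF subspace_tangent_space[of M p]]
    by (auto simp: algebra_simps)
next
  fix X assume "X \<in> vector_fields M"
  then show "h_proj \<Gamma> \<odot> X \<in> vector_fields M"
    unfolding h_proj_app using G
    by (intro subspace_scale subspace_add subspace_vector_fields[OF M])
      (auto simp: vector_1_form_def)
qed

theorem proposition3p7:
  fixes M :: "('a, 'e::euclidean_space) manifold"
    and n :: nat
    and L \<Gamma> F :: "'a vform1"
    and C :: "'a vfield"
    and B :: "'a vform2"
    and D :: "'a connection"
  assumes "smooth_manifold M"
    and "DIM('e) = 2 * n"
    and "L_structure M n L"
    and "canonical_field M L C"
    and "L_connection M L \<Gamma>"
    and "associated_almost_complex M L \<Gamma> F"
    and "vector_2_form M B"
    and "L_semibasic M L B"
    and "\<forall>Y\<in>vector_fields M. potential M L C B \<odot> Y + FN_01 C (h_proj \<Gamma>) Y = 0"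
    and "reducible_L_lift_for M L C \<Gamma> B D"
  shows "\<forall>X\<in>vector_fields M. \<forall>Y\<in>vector_fields M.
    connection_torsion D X Y =
      F \<odot> L_torsion L \<Gamma> X Y + L_curvature \<Gamma> X Y
      + app2 (i_form F B) X Y + 2 *\<^sub>R (F \<odot> app2 B X Y)"
proof -
  note M = assms(1) and Lstr = assms(3) and conn = assms(5) and assoc = assms(6)
    and B = assms(7) and semi = assms(8) and lift = assms(10)
  let ?V = "vector_fields M" and ?h = "h_proj \<Gamma>"
  note sub = subspace_vector_fields[OF M]
  have L: "vector_1_form M L" and G: "vector_1_form M \<Gamma>" and F: "vector_1_form M F"
    using Lstr conn assoc
    by (auto simp: L_structure_def L_connection_def associated_almost_complex_def)
  have h: "vector_1_form M ?h" by (rule h_proj_vector_1_form[OF M G])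
  interpret L: additive_on ?V "\<lambda>X. L \<odot> X" by (rule vector_1_form_additive[OF M L])
  interpret G: additive_on ?V "\<lambda>X. \<Gamma> \<odot> X" by (rule vector_1_form_additive[OF M G])
  interpret h: additive_on ?V "\<lambda>X. ?h \<odot> X" by (rule vector_1_form_additive[OF M h])
  interpret F: additive_on ?V "\<lambda>X. F \<odot> X" by (rule vector_1_form_additive[OF M F])
  note tan = vector_field_tangent
  have eqI: "X = Y" if "X \<in> ?V" "Y \<in> ?V" "\<And>p. p \<in> pts M \<Longrightarrow> X p = Y p" for X Y
    using vector_fields_eqI that .
  have zero: "0 \<in> ?V" using subspace_0[OF sub] .
  \<comment> \<open>Only additivity of the operators involved is available, so \<open>\<Gamma>\<close> is expressed by \<open>h\<close> without
    the scalar \<open>1/2\<close>.\<close>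
  have G2h: "\<Gamma> \<odot> X = ?h \<odot> X + ?h \<odot> X - X" for X
    by (simp add: h_proj_app scaleR_add_left[symmetric] flip: scaleR_2)

  \<comment> \<open>Commutation of \<open>D\<close> with \<open>L\<close> and
    \<open>h\<close>\<close>
  have lc: "linear_connection M D"
    and DLp: "\<And>p x Y. p \<in> pts M \<Longrightarrow> x \<in> tangent_space M p \<Longrightarrow> Y \<in> ?V \<Longrightarrow>
      D p x (L \<odot> Y) = L p (D p x Y)"
    and ind: "induces M L C D \<Gamma>"
    using lift by (auto simp: reducible_L_lift_for_def reducible_L_lift_def L_lift_def L_normal_def
        L_almost_tangent_def)
  have covL: "cov D X (L \<odot> Y) = L \<odot> cov D X Y" if "X \<in> ?V" "Y \<in> ?V" for X Y
    using that by (intro eqI L.closed cov_closed[OF lc])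
      (auto simp: cov_def app1_def[of L "\<lambda>p. D p (X p) Y"] DLp tan)
  \<comment> \<open>Reducibility provides a parallel induced connection \<Gamma>' that is not yet
    known to be \<Gamma>. Both are given by the same formula in \<open>D\<close>, so they agree on
    vector fields.\<close>
  obtain \<Gamma>' where ind': "induces M L C D \<Gamma>'" and par': "parallel M D \<Gamma>'"
    using lift by (auto simp: reducible_L_lift_for_def reducible_L_lift_def reducible_def)
  have "\<Gamma>' \<odot> X = \<Gamma> \<odot> X" if "X \<in> ?V" for X
  proof (rule eqI)
    show "\<Gamma>' \<odot> X \<in> ?V"
      using ind' that by (simp add: induces_def L_connection_def vector_1_form_def)
    show "\<Gamma> \<odot> X \<in> ?V" using that by simp
  qed (use ind ind' that in \<open>auto simp: induces_def app1_def tan\<close>)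
  then have covG: "cov D X (\<Gamma> \<odot> Y) = \<Gamma> \<odot> cov D X Y" if "X \<in> ?V" "Y \<in> ?V" for X Y
    using cov_parallel[OF lc _ par' that] ind' that cov_closed[OF lc that]
    by (simp add: induces_def L_connection_def)
  have covh: "cov D X (?h \<odot> Y) = ?h \<odot> cov D X Y" if "X \<in> ?V" "Y \<in> ?V" for X Y
  proof -
    interpret D: additive_on ?V "cov D X" by (rule cov_additive_right[OF M lc \<open>X \<in> ?V\<close>])
    \<comment> \<open>As \<Gamma> is twice \<open>?h\<close> minus the identity, commuting with
      \<Gamma> gives the claim doubled.\<close>
    have "cov D X (?h \<odot> Y) + cov D X (?h \<odot> Y) - cov D X Y = cov D X (\<Gamma> \<odot> Y)"
      using that by (simp only: G2h D.add D.diff h.closed subspace_add[OF sub])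
    also have "\<dots> = ?h \<odot> cov D X Y + ?h \<odot> cov D X Y - cov D X Y"
      using that covG by (simp add: G2h)
    finally have "2 *\<^sub>R cov D X (?h \<odot> Y) = 2 *\<^sub>R (?h \<odot> cov D X Y)"
      by (simp add: scaleR_2)
    then show ?thesis by simp
  qed

  \<comment> \<open>Relations between \<open>L\<close>, \<open>h\<close> and \<open>F\<close> on
    vector fields\<close>
  have img: "L p ` tangent_space M p = {x \<in> tangent_space M p. L p x = 0}" if "p \<in> pts M" for p
    using Lstr that by (auto simp: L_structure_def)
  have LG: "L p (\<Gamma> p x) = L p x" "\<Gamma> p (L p x) = - L p x"
    if "p \<in> pts M" "x \<in> tangent_space M p" for p x
    using conn that by (auto simp: L_connection_def)
  have LL: "L \<odot> L \<odot> X = 0" if "X \<in> ?V" for X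
    using that img by (intro eqI L.closed zero) (auto simp: app1_apply dest: tan)
  have LGf: "L \<odot> \<Gamma> \<odot> X = L \<odot> X" "\<Gamma> \<odot> L \<odot> X = - (L \<odot> X)" if "X \<in> ?V" for X
    using that by (auto intro!: eqI simp: subspace_neg[OF sub] app1_apply LG tan)
  \<comment> \<open>Stated for single tangent vectors, because the proof of \<open>LF\<close>
    applies it to a pointwise preimage under \<open>L\<close> that is not given as the value of a
    field.\<close>
  have Lh_at: "L p (?h p z) = L p z" if p: "p \<in> pts M" and z: "z \<in> tangent_space M p" for p z
  proof -
    have Gz: "\<Gamma> p z \<in> tangent_space M p"
      using G p z by (simp add: vector_1_form_def linear_on_tangent_def)
    have "linear_on_tangent M p (L p)" using L p by (simp add: vector_1_form_def)
    then have "L p (?h p z) = (1/2) *\<^sub>R (L p z + L p (\<Gamma> p z))"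
      using z Gz subspace_add[OF subspace_tangent_space z Gz]
      by (simp only: h_proj_def linear_on_tangent_def)
    then show ?thesis using p z by (simp only: LG scaleR_half_double)
  qed
  have Lh: "L \<odot> ?h \<odot> X = L \<odot> X" if "X \<in> ?V" for X
    using that by (auto intro!: eqI simp: app1_apply Lh_at tan)
  have hL: "?h \<odot> L \<odot> X = 0" if "X \<in> ?V" for X
    using LGf(2)[OF that] by (simp add: h_proj_app)
  have FL: "F \<odot> L \<odot> X = ?h \<odot> X" and Fh: "F \<odot> ?h \<odot> X = - (L \<odot> X)" if "X \<in> ?V" for X
    using that assoc
    by (auto intro!: eqI simp: subspace_neg[OF sub] app1_apply associated_almost_complex_def tan)
  have LF: "L \<odot> F \<odot> X = X - ?h \<odot> X" if X: "X \<in> ?V" for X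
  proof -
    \<comment> \<open>The form \<open>F\<close> is prescribed on the images of \<open>L\<close> and
      \<open>h\<close>, so \<open>X\<close> is split along them. At each point \<open>?v\<close>
      lies in the kernel of \<open>L\<close>, hence is some \<open>L p z\<close>, and L F L = L h =
      L. The horizontal part drops out since L F h = - L L = 0.\<close>
    let ?v = "X - ?h \<odot> X"
    have v: "?v \<in> ?V" using X by (simp add: subspace_diff[OF sub])
    have Lv: "L \<odot> ?v = 0" using X by (simp add: Lh)
    have "L \<odot> F \<odot> ?v = ?v"
    proof (rule eqI)
      fix p assume p: "p \<in> pts M"
      have "L p (?v p) = 0" using Lv by (simp add: app1_def fun_eq_iff)
      then obtain z where z: "z \<in> tangent_space M p" "?v p = L p z"
        using img[OF p] tan[OF v p] by blast
      then have "F p (L p z) = ?h p z"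
        using assoc p z by (simp add: associated_almost_complex_def)
      then show "(L \<odot> F \<odot> ?v) p = ?v p"
        by (simp only: app1_apply[of L] app1_apply[of F] z(2) Lh_at[OF p z(1)])
    qed (use v in simp_all)
    moreover have "L \<odot> F \<odot> ?h \<odot> X = 0" using X by (simp add: Fh LL)
    ultimately show ?thesis using X by simp
  qed

  \<comment> \<open>Involutivity of the vertical bundle and semibasicity of \<open>B\<close>\<close>
  have br: "lie_bracket X Y \<in> ?V" if "X \<in> ?V" "Y \<in> ?V" for X Y
    using lie_bracket_vector_field[OF M that] .
  have brLL: "L \<odot> lie_bracket (L \<odot> X) (L \<odot> Y) = 0" if "X \<in> ?V" "Y \<in> ?V" for X Y
  proof -
    \<comment> \<open>With L L = 0, the identity [L, L] = 0 expresses the bracket of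
      \<open>L \<odot> X\<close> and \<open>L \<odot> Y\<close> as \<open>L \<odot> ?Z\<close>, and
      a second application of \<open>L\<close> kills it.\<close>
    let ?Z = "lie_bracket (L \<odot> X) Y + lie_bracket X (L \<odot> Y)"
    have Z: "?Z \<in> ?V" using that by (simp add: br subspace_add[OF sub])
    have "FN_11 L L X Y = 0" using Lstr that by (simp add: L_structure_def)
    then have "2 *\<^sub>R lie_bracket (L \<odot> X) (L \<odot> Y) = 2 *\<^sub>R (L \<odot> ?Z)"
      using that by (simp add: FN_11_def LL br scaleR_2 algebra_simps)
    then have "lie_bracket (L \<odot> X) (L \<odot> Y) = L \<odot> ?Z" by simp
    then show ?thesis using LL[OF Z] by simp
  qed
  have LB: "L \<odot> app2 B X Y = 0" if "X \<in> ?V" "Y \<in> ?V" for X Y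
    using that semi
    by (intro eqI L.closed zero vector_2_form_closed[OF B])
      (auto simp: app1_apply app2_def L_semibasic_def tan)
  have BL: "app2 B (L \<odot> X) Y = 0" if "X \<in> ?V" "Y \<in> ?V" for X Y
  proof (rule eqI)
    have "L \<odot> X \<in> vertical_fields M L"
      using that by (simp add: vertical_fields_def vertical_space_def app1_apply tan)
    then show "app2 B (L \<odot> X) Y p = 0 p" if "p \<in> pts M" for p
      using semi that tan[OF \<open>Y \<in> ?V\<close>] by (simp add: L_semibasic_def app2_def)
  qed (use that zero in \<open>auto intro: vector_2_form_closed[OF B]\<close>)
  interpret reducible_lift_algebra ?V "\<lambda>X. L \<odot> X" "\<lambda>X. ?h \<odot> X" "\<lambda>X. F \<odot> X"
    lie_bracket "app2 B" "cov D"
  proof (intro reducible_lift_algebra.intro reducible_lift_algebra_axioms.intro)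
    show "lie_bracket X Y = - lie_bracket Y X" for X Y by (rule lie_bracket_skew)
    show "app2 B X Y = - app2 B Y X" if "X \<in> ?V" "Y \<in> ?V" for X Y
      using vector_2_form_skew[OF B that M] .
    show "cov D (L \<odot> X) Y - cov D Y (L \<odot> X) - lie_bracket (L \<odot> X) Y = app2 B X Y"
      if "X \<in> ?V" "Y \<in> ?V" for X Y
      using lift that by (simp add: reducible_L_lift_for_def connection_torsion_def)
  qed (simp_all add: M B lc LL Lh hL FL LF brLL LB BL covL covh
        L.additive_on_axioms h.additive_on_axioms F.additive_on_axioms
        lie_bracket_additive vector_2_form_additive cov_additive_left cov_additive_right)

  \<comment> \<open>Torsion and curvature of \<Gamma> as bracket expressions\<close>
  show ?thesis
  proof (intro ballI)
    fix X Y assume X: "X \<in> ?V" and Y: "Y \<in> ?V"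
    have hX: "?h \<odot> X \<in> ?V" and hY: "?h \<odot> Y \<in> ?V" and LX: "L \<odot> X \<in> ?V" and LY: "L \<odot> Y \<in> ?V"
      using X Y by simp_all
    \<comment> \<open>The aim is [L, \<Gamma>] = 2 [L, h], which holds because \<Gamma> = 2 h - I
      and [L, I] = 0. The facts \<open>r\<close>, \<open>l\<close> and \<open>Ld\<close> expand the
      terms containing \<Gamma>; those coming from the identity then cancel.\<close>
    have r: "lie_bracket U (\<Gamma> \<odot> W) =
      lie_bracket U (?h \<odot> W) + lie_bracket U (?h \<odot> W) - lie_bracket U W"
      if "U \<in> ?V" "W \<in> ?V" for U W
      using that by (simp only: G2h br_diff_right lie_bracket_add_right[of U M] h.closed V_closed)
    have l: "lie_bracket (\<Gamma> \<odot> W) U =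
      lie_bracket (?h \<odot> W) U + lie_bracket (?h \<odot> W) U - lie_bracket W U"
      if "U \<in> ?V" "W \<in> ?V" for U W
      using r[OF that]
      unfolding lie_bracket_skew[of "\<Gamma> \<odot> W"] lie_bracket_skew[of "?h \<odot> W"]
        lie_bracket_skew[of W]
      by simp
    have Ld: "L \<odot> (P + P - Q) = L \<odot> P + L \<odot> P - L \<odot> Q" if "P \<in> ?V" "Q \<in> ?V" for P Q
      using that by (simp only: L.add L.diff V_closed)
    have "FN_11 L \<Gamma> X Y = 2 *\<^sub>R weak_torsion X Y"
      unfolding weak_torsion_eq[OF X Y, symmetric] FN_11_def
        r[OF X Y] r[OF LX Y] l[OF Y X] l[OF LY X]
      unfolding G2h Ld[OF br[OF X hY] br[OF X Y]] Ld[OF br[OF hX Y] br[OF X Y]]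
        Ld[OF h.closed[OF br[OF X Y]] br[OF X Y]]
      using X Y by (simp add: scaleR_2 algebra_simps)
    then have T: "L_torsion L \<Gamma> X Y = weak_torsion X Y" by (simp add: L_torsion_def)
    \<comment> \<open>With both forms equal to \<open>?h\<close> and h h = h, every term of the
      bracket occurs twice, which gives twice the left side of \<open>curvature_eq\<close>.\<close>
    have "FN_11 ?h ?h X Y = 2 *\<^sub>R v (lie_bracket (?h \<odot> X) (?h \<odot> Y))"
      unfolding curvature_eq[OF X Y, symmetric] FN_11_def
      using X Y by (simp add: scaleR_2 algebra_simps)
    then have Om: "L_curvature \<Gamma> X Y = - v (lie_bracket (?h \<odot> X) (?h \<odot> Y))"
      by (simp add: L_curvature_def)
    have "app2 (i_form F B) X Y = app2 B (F \<odot> X) Y + app2 B X (F \<odot> Y)"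
      by (simp add: app2_def i_form_def app1_def fun_eq_iff)
    then show "connection_torsion D X Y =
      F \<odot> L_torsion L \<Gamma> X Y + L_curvature \<Gamma> X Y
      + app2 (i_form F B) X Y + 2 *\<^sub>R (F \<odot> app2 B X Y)"
      using torsion_formula[OF X Y]
      by (simp add: T Om torsion_def connection_torsion_def scaleR_2)
  qed
qed

end
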